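(* Each Casimir element of the Racah algebra $\Re$ is central in $\Re$.
   Context: $\mathbb F$ is a field with $\operatorname{char}\mathbb F\neq 2$. All algebras are unital and associative, and a subalgebra has the same unit as the parent algebra. Write $[x,y]=xy-yx$ and $\{x,y\}=xy+yx$. The Racah algebra $\Re$ is the $\mathbb F$-algebra defined by generators $A,B,C,D$ and the relations $[A,B]=[B,C]=[C,A]=2D$ together with the relations asserting that each of the elements $$\alpha=[A,D]+AC-BA,\qquad \beta=[B,D]+BA-CB,\qquad \gamma=[C,D]+CB-AC$$ is central in $\Re$. Set $\delta=A+B+C$. Let $\mathfrak C$ denote the $\mathbb F$-subalgebra of $\Re$ generated by $\alpha,\beta,\gamma,\delta$. The Casimir class of $\Re$ is the coset $$D^2+A^2+B^2+\frac{(\delta+2)\{A,B\}-\{A^2,B\}-\{A,B^2\}}{2}+A(\beta-\delta)-B(\delta+\alpha)+\mathfrak C$$ of $\mathfrak C$ in $\Re$; each element of this coset is called a Casimir element of $\Re$. *)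

theory Defs
  imports Complex_Main "HOL-Library.Poly_Mapping"
begin

definition commutator :: "'a::ring \<Rightarrow> 'a \<Rightarrow> 'a" where
  "commutator x y = x * y - y * x"

definition anticommutator :: "'a::ring \<Rightarrow> 'a \<Rightarrow> 'a" where
  "anticommutator x y = x * y + y * x"

definition ring_center :: "'a::ring set" where
  "ring_center = {z. \<forall>x. z * x = x * z}"

datatype racah_gen = GenA | GenB | GenC | GenD

text \<open>Words are written additively because the product on \<^typ>\<open>'k \<Rightarrow>\<^sub>0 'f\<close> is the convolution
  product for an additive monoid of exponents.  The monoid is not commutative, so
  \<open>racah_word \<Rightarrow>\<^sub>0 'f\<close> is the free unital associative algebra on \<^typ>\<open>racah_gen\<close>.\<close>

datatype racah_word = Word "racah_gen list"

instantiation racah_word :: monoid_add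
begin

definition zero_racah_word :: racah_word where
  "0 = Word []"

fun plus_racah_word :: "racah_word \<Rightarrow> racah_word \<Rightarrow> racah_word" where
  "Word u + Word v = Word (u @ v)"

instance
proof
  fix u v w :: racah_word
  show "u + v + w = u + (v + w)" by (cases u; cases v; cases w) simp
  show "0 + u = u" by (cases u) (simp add: zero_racah_word_def)
  show "u + 0 = u" by (cases u) (simp add: zero_racah_word_def)
qed

end

type_synonym 'f free_racah = "racah_word \<Rightarrow>\<^sub>0 'f"

definition free_gen :: "racah_gen \<Rightarrow> 'f::field free_racah" where
  "free_gen g = Poly_Mapping.single (Word [g]) 1"

definition alpha_expr :: "'a::ring \<Rightarrow> 'a \<Rightarrow> 'a \<Rightarrow> 'a \<Rightarrow> 'a" where
  "alpha_expr a b c d = commutator a d + a * c - b * a"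

definition beta_expr :: "'a::ring \<Rightarrow> 'a \<Rightarrow> 'a \<Rightarrow> 'a \<Rightarrow> 'a" where
  "beta_expr a b c d = commutator b d + b * a - c * b"

definition gamma_expr :: "'a::ring \<Rightarrow> 'a \<Rightarrow> 'a \<Rightarrow> 'a \<Rightarrow> 'a" where
  "gamma_expr a b c d = commutator c d + c * b - a * c"

definition racah_relators :: "'f::field free_racah set" where
  "racah_relators =
    (let a = free_gen GenA; b = free_gen GenB; c = free_gen GenC; d = free_gen GenD in
      {commutator a b - 2 * d, commutator b c - 2 * d, commutator c a - 2 * d}
      \<union> {commutator (alpha_expr a b c d) x | x. True}
      \<union> {commutator (beta_expr a b c d) x | x. True}
      \<union> {commutator (gamma_expr a b c d) x | x. True})"

text \<open>Finite sums of elements \<open>x * r * y\<close>; scalars and signs are absorbed by \<open>x\<close>.\<close>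

inductive_set racah_ideal :: "'f::field free_racah set" where
  zero: "0 \<in> racah_ideal"
| add: "p \<in> racah_ideal \<Longrightarrow> q \<in> racah_ideal \<Longrightarrow> p + q \<in> racah_ideal"
| relator: "r \<in> racah_relators \<Longrightarrow> x * r * y \<in> racah_ideal"

lemma racah_ideal_mult_left: "p \<in> racah_ideal \<Longrightarrow> z * p \<in> racah_ideal"
proof (induction rule: racah_ideal.induct)
  case (relator r x y)
  then show ?case
    using racah_ideal.relator[of r "z * x" y] by (simp add: mult.assoc)
qed (simp_all add: racah_ideal.zero racah_ideal.add distrib_left)

lemma racah_ideal_mult_right: "p \<in> racah_ideal \<Longrightarrow> p * z \<in> racah_ideal"
proof (induction rule: racah_ideal.induct)
  case (relator r x y)
  then show ?case
    using racah_ideal.relator[of r x "y * z"] by (simp add: mult.assoc)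
qed (simp_all add: racah_ideal.zero racah_ideal.add distrib_right)

lemma racah_ideal_uminus: "p \<in> racah_ideal \<Longrightarrow> - p \<in> racah_ideal"
  using racah_ideal_mult_left[of p "- 1"] by simp

lemma racah_ideal_diff: "p \<in> racah_ideal \<Longrightarrow> q \<in> racah_ideal \<Longrightarrow> p - q \<in> racah_ideal"
  using racah_ideal.add[OF _ racah_ideal_uminus, of p q] by simp

text \<open>The augmentation sending all generators to 0 kills the ideal, so the quotient is nonzero.\<close>

lemma racah_word_add_eq_0: "0 = u + v \<longleftrightarrow> u = 0 \<and> v = (0 :: racah_word)"
  by (cases u; cases v) (auto simp: zero_racah_word_def)

lemma lookup_mult_0:
  fixes p q :: "'f::field free_racah"
  shows "Poly_Mapping.lookup (p * q) 0 = Poly_Mapping.lookup p 0 * Poly_Mapping.lookup q 0"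
proof -
  have "(\<Sum>v. Poly_Mapping.lookup q v when 0 = u + v) = (Poly_Mapping.lookup q 0 when u = 0)" for u
    by (cases "u = 0") (simp_all add: racah_word_add_eq_0)
  then show ?thesis
    by (simp add: lookup_mult mult_when)
qed

lemma lookup_racah_ideal_0: "p \<in> racah_ideal \<Longrightarrow> Poly_Mapping.lookup p 0 = 0"
proof (induction rule: racah_ideal.induct)
  case (relator r x y)
  have "Poly_Mapping.lookup (free_gen g :: 'a free_racah) 0 = 0" for g
    by (simp add: free_gen_def lookup_single zero_racah_word_def)
  with relator have "Poly_Mapping.lookup r 0 = 0"
    by (auto simp: racah_relators_def Let_def commutator_def alpha_expr_def beta_expr_def
        gamma_expr_def lookup_add lookup_minus lookup_mult_0)
  then show ?case by (simp add: lookup_mult_0)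
qed (simp_all add: lookup_add)

definition racah_cong :: "'f::field free_racah \<Rightarrow> 'f free_racah \<Rightarrow> bool" where
  "racah_cong p q \<longleftrightarrow> p - q \<in> racah_ideal"

quotient_type (overloaded) 'f racah = "'f::field free_racah" / racah_cong
proof (rule equivpI)
  show "reflp racah_cong" by (simp add: reflp_def racah_cong_def racah_ideal.zero)
  show "symp racah_cong"
    using racah_ideal_uminus by (fastforce simp: symp_def racah_cong_def)
  show "transp racah_cong"
    using racah_ideal.add by (fastforce simp: transp_def racah_cong_def)
qed

instantiation racah :: (field) ring_1
begin

lift_definition zero_racah :: "'a racah" is 0 .
lift_definition one_racah :: "'a racah" is 1 .

lift_definition plus_racah :: "'a racah \<Rightarrow> 'a racah \<Rightarrow> 'a racah" is "(+)"
  using racah_ideal.add by (fastforce simp: racah_cong_def algebra_simps)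

lift_definition minus_racah :: "'a racah \<Rightarrow> 'a racah \<Rightarrow> 'a racah" is "(-)"
  using racah_ideal_diff by (fastforce simp: racah_cong_def algebra_simps)

lift_definition uminus_racah :: "'a racah \<Rightarrow> 'a racah" is uminus
  using racah_ideal_uminus by (fastforce simp: racah_cong_def algebra_simps)

lift_definition times_racah :: "'a racah \<Rightarrow> 'a racah \<Rightarrow> 'a racah" is "(*)"
proof -
  fix p p' q q' :: "'a free_racah"
  assume "racah_cong p p'" "racah_cong q q'"
  then have "(p - p') * q + p' * (q - q') \<in> racah_ideal"
    unfolding racah_cong_def
    by (intro racah_ideal.add racah_ideal_mult_left racah_ideal_mult_right)
  then show "racah_cong (p * q) (p' * q')"
    by (simp add: racah_cong_def algebra_simps)
qed

instance
proof
  show "(0::'a racah) \<noteq> 1"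
  proof transfer
    show "\<not> racah_cong (0::'a free_racah) 1"
      using lookup_racah_ideal_0[of "0 - 1 :: 'a free_racah"]
      by (auto simp: racah_cong_def lookup_minus lookup_one)
  qed
qed (transfer; simp add: racah_cong_def racah_ideal.zero algebra_simps)+

end

text \<open>\<open>single 0 c\<close> is \<open>c\<close> times the empty word, i.e. the scalar \<open>c\<close> of the free algebra.\<close>

lift_definition racah_scale :: "'f::field \<Rightarrow> 'f racah \<Rightarrow> 'f racah"
  is "\<lambda>c p. Poly_Mapping.single 0 c * p"
  using racah_ideal_mult_left by (fastforce simp: racah_cong_def algebra_simps)

lift_definition racah_A :: "'f::field racah" is "free_gen GenA" .
lift_definition racah_B :: "'f::field racah" is "free_gen GenB" .
lift_definition racah_C :: "'f::field racah" is "free_gen GenC" .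
lift_definition racah_D :: "'f::field racah" is "free_gen GenD" .

definition racah_alpha :: "'f::field racah" where
  "racah_alpha = alpha_expr racah_A racah_B racah_C racah_D"

definition racah_beta :: "'f::field racah" where
  "racah_beta = beta_expr racah_A racah_B racah_C racah_D"

definition racah_gamma :: "'f::field racah" where
  "racah_gamma = gamma_expr racah_A racah_B racah_C racah_D"

definition racah_delta :: "'f::field racah" where
  "racah_delta = racah_A + racah_B + racah_C"

definition racah_subalgebra :: "'f::field racah set \<Rightarrow> bool" where
  "racah_subalgebra S \<longleftrightarrow> 1 \<in> S \<and> (\<forall>x\<in>S. \<forall>y\<in>S. x + y \<in> S) \<and> (\<forall>x\<in>S. \<forall>y\<in>S. x * y \<in> S)
    \<and> (\<forall>c. \<forall>x\<in>S. racah_scale c x \<in> S)"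

definition racah_frakC :: "'f::field racah set" where
  "racah_frakC = racah_subalgebra hull {racah_alpha, racah_beta, racah_gamma, racah_delta}"

definition casimir_representative :: "'f::field racah" where
  "casimir_representative =
    (let A = racah_A; B = racah_B; D = racah_D;
         \<alpha> = racah_alpha; \<beta> = racah_beta; \<delta> = racah_delta in
      D^2 + A^2 + B^2
      + racah_scale (1 / 2) ((\<delta> + 2) * anticommutator A B - anticommutator (A^2) B
                              - anticommutator A (B^2))
      + A * (\<beta> - \<delta>) - B * (\<delta> + \<alpha>))"

definition casimir_class :: "'f::field racah set" where
  "casimir_class = {casimir_representative + c | c. c \<in> racah_frakC}"

end

theory Submission
  imports Defs "HOL-Computational_Algebra.Primes"
begin

text \<open>An element commuting with \<open>A\<close> and \<open>B\<close> commutes with \<open>2 D = [A,B]\<close>, hence with \<open>D\<close> because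
  \<open>2\<close> is invertible.  This gives centrality of \<open>\<delta>\<close>, and then \<open>C = \<delta> - A - B\<close> shows that every element
  commuting with \<open>A\<close> and \<open>B\<close> is central.  Eliminating \<open>C\<close>, the relations rewrite \<open>B A\<close>, \<open>D A\<close> and
  \<open>D B\<close> into ordered monomials in \<open>A, B, D\<close> with coefficients in the central elements
  \<open>\<alpha>, \<beta>, \<delta>\<close>.  Comparing ordered forms shows that twice the Casimir representative commutes with
  \<open>A\<close> and \<open>B\<close>.\<close>

text \<open>Multiples are written as repeated sums: the simplifier then compares the two ordered forms by
  additive cancellation, without having to commute numerals past noncommuting factors.\<close>

lemma casimir_double_commutes:
  fixes a b d \<alpha> \<beta> \<delta> :: "'a::ring_1"
  assumes ba: "b * a = a * b - (d + d)"
    and da: "d * a = a * d - (\<alpha> - a * \<delta> + a * a + a * b + b * a)"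
    and db: "d * b = b * d - (\<beta> - b * a + \<delta> * b - a * b - b * b)"
    and \<alpha>: "\<And>x. x * \<alpha> = \<alpha> * x" and \<beta>: "\<And>x. x * \<beta> = \<beta> * x" and \<delta>: "\<And>x. x * \<delta> = \<delta> * x"
    and \<Omega>: "\<Omega> = d * d + a * a + b * b + (a * (\<beta> - \<delta>) - b * (\<delta> + \<alpha>))"
    and W: "W = (\<delta> + (1 + 1)) * (a * b + b * a) - (a * a * b + b * (a * a)) - (a * (b * b) + b * b * a)"
  shows "(\<Omega> + \<Omega> + W) * a = a * (\<Omega> + \<Omega> + W)" "(\<Omega> + \<Omega> + W) * b = b * (\<Omega> + \<Omega> + W)"
proof -
  have c: "a * \<alpha> = \<alpha> * a" "b * \<alpha> = \<alpha> * b" "d * \<alpha> = \<alpha> * d"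
          "a * \<beta> = \<beta> * a" "b * \<beta> = \<beta> * b" "d * \<beta> = \<beta> * d" "\<beta> * \<alpha> = \<alpha> * \<beta>"
          "a * \<delta> = \<delta> * a" "b * \<delta> = \<delta> * b" "d * \<delta> = \<delta> * d" "\<delta> * \<alpha> = \<alpha> * \<delta>" "\<delta> * \<beta> = \<beta> * \<delta>"
    by (rule \<alpha> \<beta> \<delta>)+
  \<comment> \<open>Products are nested to the right, so every rewrite rule also needs a form with a
    trailing factor; \<open>cl\<close>, \<open>bal\<close>, \<open>dal\<close> and
    \<open>dbl\<close> are these forms.\<close>
  have pull: "x * (y * z) = y * (x * z)" if "x * y = y * x" for x y z :: 'a
    using that by (metis mult.assoc)
  note cl = c[THEN pull]
  have bal: "b * (a * y) = a * (b * y) - (d * y + d * y)" for y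
    by (metis ba mult.assoc left_diff_distrib distrib_right)
  \<comment> \<open>\<open>ba\<close> turns the remaining \<open>b * a\<close> into
    \<open>a * b\<close>, leaving ordered monomials: central elements first, then \<open>a\<close>,
    \<open>b\<close>, \<open>d\<close>.\<close>
  have da': "d * a = a * d - \<alpha> + \<delta> * a - a * a - a * b - a * b + d + d"
    unfolding da ba c by (simp add: algebra_simps)
  have db': "d * b = b * d - \<beta> + a * b + a * b - d - d - \<delta> * b + b * b"
    unfolding db ba c by (simp add: algebra_simps)
  have dal: "d * (a * y) =
      a * (d * y) - \<alpha> * y + \<delta> * (a * y) - a * (a * y) - a * (b * y) - a * (b * y) + d * y + d * y" for y
    using arg_cong[OF da', of "\<lambda>x. x * y"] by (simp add: algebra_simps)
  have dbl: "d * (b * y) =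
      b * (d * y) - \<beta> * y + a * (b * y) + a * (b * y) - d * y - d * y - \<delta> * (b * y) + b * (b * y)" for y
    using arg_cong[OF db', of "\<lambda>x. x * y"] by (simp add: algebra_simps)
  note rules = c cl ba bal da' dal db' dbl distrib_left distrib_right left_diff_distrib
    right_diff_distrib mult.assoc mult_1_left mult_1_right
  show "(\<Omega> + \<Omega> + W) * a = a * (\<Omega> + \<Omega> + W)"
    unfolding \<Omega> W by (simp only: rules) (simp add: algebra_simps)
  show "(\<Omega> + \<Omega> + W) * b = b * (\<Omega> + \<Omega> + W)"
    unfolding \<Omega> W by (simp only: rules) (simp add: algebra_simps)
qed

lemma racah_ideal_relator: "r \<in> racah_relators \<Longrightarrow> r \<in> racah_ideal"
  using racah_ideal.relator[of r 1 1] by simp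

lemma racah_commutation_relations:
  "racah_A * racah_B = (racah_B * racah_A + (racah_D + racah_D) :: 'f::field racah)"
  "racah_B * racah_C = (racah_C * racah_B + (racah_D + racah_D) :: 'f racah)"
  "racah_C * racah_A = (racah_A * racah_C + (racah_D + racah_D) :: 'f racah)"
  by (transfer; unfold racah_cong_def mult_2[symmetric] diff_diff_eq[symmetric];
      rule racah_ideal_relator; simp add: racah_relators_def Let_def commutator_def)+

lemma racah_alpha_central: "racah_alpha \<in> ring_center"
  and racah_beta_central: "racah_beta \<in> ring_center"
  and racah_gamma_central: "racah_gamma \<in> ring_center"
  unfolding ring_center_def racah_alpha_def racah_beta_def racah_gamma_def alpha_expr_def
    beta_expr_def gamma_expr_def commutator_def mem_Collect_eq
  by (transfer; unfold racah_cong_def; intro allI racah_ideal_relator;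
      auto simp: racah_relators_def Let_def commutator_def alpha_expr_def beta_expr_def gamma_expr_def)+

lemma poly_mapping_single_induct [case_names single add]:
  fixes p :: "'a \<Rightarrow>\<^sub>0 'b::monoid_add"
  assumes "\<And>w c. P (Poly_Mapping.single w c)" and "\<And>p q. P p \<Longrightarrow> P q \<Longrightarrow> P (p + q)"
  shows "P p"
proof (induction p rule: update_induct)
  case const
  \<comment> \<open>The zero mapping is a single term with coefficient 0, at an arbitrary
    key.\<close>
  then show ?case using assms(1)[of undefined 0] by simp
next
  case (update f k v)
  have "Poly_Mapping.update k v f = f + Poly_Mapping.single k v"
    using update.hyps by (intro poly_mapping_eqI)
      (auto simp: lookup_update lookup_add lookup_single when_def not_in_keys_iff_lookup_eq_zero)
  then show ?case using assms update.IH by simp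
qed

text \<open>The empty word is neutral on both sides and coefficients commute, so scalars are central
  in the free algebra.\<close>

lemma free_scalar_commute:
  fixes p :: "'f::field free_racah"
  shows "p * Poly_Mapping.single 0 c = Poly_Mapping.single 0 c * p"
  by (induction p rule: poly_mapping_single_induct) (simp_all add: mult_single algebra_simps)

lemma racah_scale_mult_left: "racah_scale c x * y = racah_scale c (x * y)"
  by transfer (simp add: racah_cong_def mult.assoc racah_ideal.zero)

lemma racah_scale_mult_right: "x * racah_scale c y = racah_scale c (x * y)"
  by transfer (metis free_scalar_commute mult.assoc racah_cong_def diff_self racah_ideal.zero)

lemma racah_scale_scale: "racah_scale c (racah_scale e x) = racah_scale (c * e) x"
  by transfer (simp add: racah_cong_def mult.assoc[symmetric] mult_single racah_ideal.zero)

lemma racah_scale_2: "racah_scale 2 x = x + x"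
  by transfer (simp add: racah_cong_def mult_2 racah_ideal.zero)

lemma racah_scale_1: "racah_scale 1 x = x"
  by transfer (simp add: racah_cong_def racah_ideal.zero)

lemma two_neq_0_if_CHAR_neq_2:
  assumes "CHAR('f::field) \<noteq> 2"
  shows "(2::'f) \<noteq> 0"
proof
  assume "(2::'f) = 0"
  then have "CHAR('f) dvd 2"
    using of_nat_eq_0_iff_char_dvd[where 'a = 'f, of 2] by simp
  \<comment> \<open>2 is prime, so its only other divisor is 1, which is not the characteristic of a
    field.\<close>
  then have "CHAR('f) = 1"
    using assms by (metis two_is_prime_nat prime_nat_iff)
  then show False by simp
qed

text \<open>Scaling by 1/2 undoes doubling. Identities can thus be checked after doubling, free of
  fractions.\<close>

lemma racah_double_cancel:
  fixes x y :: "'f::field racah"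
  assumes "CHAR('f) \<noteq> 2" and "x + x = y + y"
  shows "x = y"
proof -
  note two = two_neq_0_if_CHAR_neq_2[OF assms(1)]
  show ?thesis
    by (metis two assms(2) racah_scale_1 racah_scale_2 racah_scale_scale nonzero_eq_divide_eq)
qed

text \<open>The elements commuting with \<open>z\<close> are closed under products, scalar multiples
  and sums, and the words in the generators span the algebra.\<close>

lemma racah_centerI:
  fixes z :: "'f::field racah"
  assumes "z * racah_A = racah_A * z" "z * racah_B = racah_B * z"
    "z * racah_C = racah_C * z" "z * racah_D = racah_D * z"
  shows "z \<in> ring_center"
proof -
  have scalar: "z * abs_racah (Poly_Mapping.single 0 c * p)
      = abs_racah (Poly_Mapping.single 0 c * p) * z"
    if "z * abs_racah p = abs_racah p * z" for c p
    using that racah_scale_mult_left racah_scale_mult_right by (metis racah_scale.abs_eq)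
  have gen: "z * abs_racah (free_gen g) = abs_racah (free_gen g) * z" for g
    using assms unfolding racah_A_def racah_B_def racah_C_def racah_D_def by (cases g) simp_all
  have word: "z * abs_racah (Poly_Mapping.single (Word w) 1)
      = abs_racah (Poly_Mapping.single (Word w) 1) * z" for w
  proof (induction w)
    case Nil
    have "abs_racah (Poly_Mapping.single (Word []) 1) = (1 :: 'f racah)"
      by (simp add: one_racah_def single_one flip: zero_racah_word_def)
    then show ?case by simp
  next
    case (Cons g w)
    have "Poly_Mapping.single (Word (g # w)) (1::'f) = free_gen g * Poly_Mapping.single (Word w) 1"
      by (simp add: free_gen_def mult_single)
    then have "abs_racah (Poly_Mapping.single (Word (g # w)) (1::'f))
        = abs_racah (free_gen g) * abs_racah (Poly_Mapping.single (Word w) 1)"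
      by (simp add: times_racah.abs_eq)
    then show ?case using gen Cons by (metis mult.assoc)
  qed
  have "z * abs_racah p = abs_racah p * z" for p
  proof (induction p rule: poly_mapping_single_induct)
    case (single w c)
    obtain u where "w = Word u" by (cases w)
    then show ?case
      using scalar[OF word[of u], of c] by (simp add: mult_single)
  next
    case (add p q)
    then show ?case
      by (simp add: distrib_left distrib_right flip: plus_racah.abs_eq)
  qed
  then show ?thesis
    unfolding ring_center_def mem_Collect_eq by (metis Quotient3_racah Quotient3_abs_rep)
qed

lemma racah_centerD: "z \<in> ring_center \<Longrightarrow> z * x = x * z"
  by (simp add: ring_center_def)

text \<open>By minimality of the hull, \<open>racah_frakC\<close> is central once its four
  generators are.\<close>

lemma racah_subalgebra_center: "racah_subalgebra (ring_center :: 'f::field racah set)"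
  unfolding racah_subalgebra_def
proof (intro conjI ballI allI)
  fix x y :: "'f racah" and c
  assume x: "x \<in> ring_center"
  show "racah_scale c x \<in> ring_center"
    using x by (simp add: ring_center_def racah_scale_mult_left racah_scale_mult_right)
  assume y: "y \<in> ring_center"
  show "x + y \<in> ring_center"
    using x y by (simp add: ring_center_def distrib_left distrib_right)
  have "x * y * z = z * (x * y)" for z
    by (metis racah_centerD[OF x] racah_centerD[OF y] mult.assoc)
  then show "x * y \<in> ring_center"
    by (simp add: ring_center_def)
qed (simp add: ring_center_def)

lemma commutes_with_D:
  fixes z :: "'f::field racah"
  assumes "CHAR('f) \<noteq> 2" and A: "z * racah_A = racah_A * z" and B: "z * racah_B = racah_B * z"
  shows "z * racah_D = racah_D * z"
proof (rule racah_double_cancel[OF assms(1)])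
  let ?A = "racah_A :: 'f racah" and ?B = "racah_B :: 'f racah" and ?D = "racah_D :: 'f racah"
  have D: "?D + ?D = ?A * ?B - ?B * ?A"
    by (simp add: racah_commutation_relations(1))
  have "z * ?D + z * ?D = z * (?A * ?B - ?B * ?A)"
    by (simp only: D flip: distrib_left)
  \<comment> \<open>The reversed associativity regroups \<open>z * (x * y)\<close> as
    \<open>(z * x) * y\<close>, so that \<open>z\<close> can move right past one factor at a
    time.\<close>
  also have "\<dots> = (?A * ?B - ?B * ?A) * z"
    by (simp only: left_diff_distrib right_diff_distrib mult.assoc A B
        mult.assoc[of z, symmetric])
  also have "\<dots> = ?D * z + ?D * z"
    by (simp only: D flip: distrib_right)
  finally show "z * ?D + z * ?D = ?D * z + ?D * z" .
qed

text \<open>The relations are cyclic: the commutator of \<delta> with each of A, B, C is a sum of 2D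
  and -2D. Commuting with D then follows from A and B.\<close>

lemma racah_delta_central:
  assumes "CHAR('f::field) \<noteq> 2"
  shows "racah_delta \<in> (ring_center :: 'f racah set)"
proof (rule racah_centerI)
  let ?A = "racah_A :: 'f racah" and ?B = "racah_B :: 'f racah"
    and ?C = "racah_C :: 'f racah" and ?D = "racah_D :: 'f racah"
  show A: "racah_delta * ?A = ?A * racah_delta"
    by (simp only: racah_delta_def distrib_left distrib_right racah_commutation_relations add_ac)
  show B: "racah_delta * ?B = ?B * racah_delta"
    by (simp only: racah_delta_def distrib_left distrib_right racah_commutation_relations add_ac)
  show "racah_delta * ?C = ?C * racah_delta"
    by (simp only: racah_delta_def distrib_left distrib_right racah_commutation_relations add_ac)
  show "racah_delta * ?D = ?D * racah_delta"
    by (rule commutes_with_D[OF assms A B])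
qed

lemma casimir_representative_central:
  assumes "CHAR('f::field) \<noteq> 2"
  shows "casimir_representative \<in> (ring_center :: 'f racah set)"
proof -
  let ?\<Omega> = "casimir_representative :: 'f racah"
  let ?A = "racah_A :: 'f racah" and ?B = "racah_B :: 'f racah"
    and ?C = "racah_C :: 'f racah" and ?D = "racah_D :: 'f racah"
    and ?\<alpha> = "racah_alpha :: 'f racah" and ?\<beta> = "racah_beta :: 'f racah"
    and ?\<delta> = "racah_delta :: 'f racah"
  \<comment> \<open>\<open>Q\<close> collects the terms without a fraction and \<open>W\<close> is
    the numerator of the half, so twice the representative is \<open>Q + Q + W\<close>.\<close>
  define Q where "Q = ?D * ?D + ?A * ?A + ?B * ?B + (?A * (?\<beta> - ?\<delta>) - ?B * (?\<delta> + ?\<alpha>))"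
  define W where "W = (?\<delta> + (1 + 1)) * (?A * ?B + ?B * ?A) - (?A * ?A * ?B + ?B * (?A * ?A))
    - (?A * (?B * ?B) + ?B * ?B * ?A)"
  note two = two_neq_0_if_CHAR_neq_2[OF assms]
  have half: "racah_scale (1/2) x + racah_scale (1/2) x = x" for x :: "'f racah"
    using two by (simp add: racah_scale_scale racah_scale_1 flip: racah_scale_2)
  have "?\<Omega> + ?\<Omega> = Q + Q + (racah_scale (1/2) W + racah_scale (1/2) W)"
    unfolding casimir_representative_def Q_def W_def Let_def anticommutator_def power2_eq_square
    by (simp add: algebra_simps)
  then have double: "?\<Omega> + ?\<Omega> = Q + Q + W"
    by (simp only: half)
  have C: "?C = ?\<delta> - ?A - ?B" by (simp add: racah_delta_def)
  note \<alpha> = racah_centerD[OF racah_alpha_central, symmetric]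
    and \<beta> = racah_centerD[OF racah_beta_central, symmetric]
    and \<delta> = racah_centerD[OF racah_delta_central[OF assms], symmetric]
  have ba: "?B * ?A = ?A * ?B - (?D + ?D)"
    by (simp add: racah_commutation_relations(1))
  \<comment> \<open>The definition of \<alpha>, and below that of \<beta>, solved for the product
    starting with D, with C replaced by \<delta> - A - B.\<close>
  have da: "?D * ?A = ?A * ?D - (?\<alpha> - ?A * ?\<delta> + ?A * ?A + ?A * ?B + ?B * ?A)"
    by (simp add: racah_alpha_def racah_delta_def alpha_expr_def commutator_def algebra_simps)
  have db: "?D * ?B = ?B * ?D - (?\<beta> - ?B * ?A + ?\<delta> * ?B - ?A * ?B - ?B * ?B)"
    by (simp add: racah_beta_def racah_delta_def beta_expr_def commutator_def algebra_simps)
  note comm = casimir_double_commutes[OF ba da db \<alpha> \<beta> \<delta> Q_def W_def, folded double]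
  have A: "?\<Omega> * ?A = ?A * ?\<Omega>"
    using comm(1) by - (rule racah_double_cancel[OF assms], simp add: distrib_left distrib_right)
  have B: "?\<Omega> * ?B = ?B * ?\<Omega>"
    using comm(2) by - (rule racah_double_cancel[OF assms], simp add: distrib_left distrib_right)
  show ?thesis
  proof (rule racah_centerI[OF A B])
    show "?\<Omega> * ?C = ?C * ?\<Omega>"
      unfolding C left_diff_distrib right_diff_distrib by (simp only: A B \<delta>)
    show "?\<Omega> * ?D = ?D * ?\<Omega>"
      by (rule commutes_with_D[OF assms A B])
  qed
qed

theorem proposition6p7:
  fixes \<Omega> :: "'f::field racah"
  assumes "CHAR('f) \<noteq> 2"
    and "\<Omega> \<in> casimir_class"
  shows "\<Omega> \<in> ring_center"
proof -
  have "racah_frakC \<subseteq> (ring_center :: 'f racah set)"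
    unfolding racah_frakC_def
    by (rule hull_minimal) (simp_all add: racah_alpha_central racah_beta_central
        racah_gamma_central racah_delta_central assms racah_subalgebra_center)
  moreover obtain c where "\<Omega> = casimir_representative + c" "c \<in> racah_frakC"
    using assms(2) by (auto simp: casimir_class_def)
  ultimately show ?thesis
    using casimir_representative_central[OF assms(1)] racah_subalgebra_center[where 'f = 'f]
    unfolding racah_subalgebra_def by blast
qed

end
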